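(* Let $E_{n,\mathrm{fix}}$ denote the set of elements of $E_n$ that fix at least one leaf of $T_n$. Then \[ \frac{|E_{n,\mathrm{fix}}|}{|E_n|} = \frac{2}{n}\left(1 + O\left(\frac{\log n}{n}\right)\right) \quad \text{as } n \to \infty. \]
   Context: $T_n$ is the regular ternary rooted tree with $n$ levels: vertices at level $i$ are sequences $(\ell_1,\dots,\ell_i)$ with $\ell_j\in\{1,2,3\}$, and $(\ell_1,\dots,\ell_i)$ is joined to $(\ell_1,\dots,\ell_{i+1})$; its leaves are the $3^n$ vertices of level $n$. $\mathrm{Aut}(T_n)$ is identified with $\mathrm{Aut}(T_{n-1})\wr\mathrm{Aut}(T_1)$: $((a_1,a_2,a_3),b)$ sends $(i,\ell_2,\dots,\ell_k)$ to $(b(i),a_i(\ell_2,\dots,\ell_k))$. $\mathrm{sgn}_2(\sigma)$ is the sign of the permutation induced by $\sigma$ on the 9 vertices of level $2$. Define $E_1=\mathrm{Aut}(T_1)\cong\mathfrak S_3$ and, for $n\ge2$, $E_n=\{\sigma=((a_1,a_2,a_3),b)\in\mathrm{Aut}(T_n): a_1,a_2,a_3\in E_{n-1},\ \mathrm{sgn}_2(\sigma)=1\}$. *)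

theory Defs
  imports Complex_Main "HOL-Combinatorics.Combinatorics" "HOL-Library.Landau_Symbols"
begin

text \<open>A vertex is the sequence of its labels; the empty list is the root.\<close>

definition labels :: "nat set" where
  "labels = {1, 2, 3}"

definition level :: "nat \<Rightarrow> nat list set" where
  "level i = {v. length v = i \<and> set v \<subseteq> labels}"

definition verts :: "nat \<Rightarrow> nat list set" where
  "verts n = (\<Union>i\<le>n. level i)"

definition adjacent :: "nat list \<Rightarrow> nat list \<Rightarrow> bool" where
  "adjacent v w \<longleftrightarrow> (\<exists>l. w = v @ [l] \<or> v = w @ [l])"

text \<open>
  Automorphisms of the rooted tree with \<open>n\<close> levels. As usual for \<open>permutes\<close>, they are
  extended by the identity outside the vertex set, so that distinct functions are distinct
  automorphisms and cardinalities are the intended ones.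
\<close>

definition Aut :: "nat \<Rightarrow> (nat list \<Rightarrow> nat list) set" where
  "Aut n = {\<sigma>. \<sigma> permutes verts n \<and> \<sigma> [] = [] \<and>
     (\<forall>v\<in>verts n. \<forall>w\<in>verts n. adjacent (\<sigma> v) (\<sigma> w) \<longleftrightarrow> adjacent v w)}"

text \<open>
  \<open>wreath_decomp n \<sigma> a b\<close>: the element \<open>\<sigma>\<close> of \<open>Aut (Suc n)\<close> is identified with
  \<open>((a 1, a 2, a 3), b)\<close>. Here \<open>b\<close> is an element of \<open>Aut 1\<close>, so \<open>b(i)\<close> as a label is
  the single entry of the list \<open>b [i]\<close>.
\<close>

definition wreath_decomp ::
  "nat \<Rightarrow> (nat list \<Rightarrow> nat list) \<Rightarrow> (nat \<Rightarrow> nat list \<Rightarrow> nat list) \<Rightarrow> (nat list \<Rightarrow> nat list) \<Rightarrow> bool"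
where
  "wreath_decomp n \<sigma> a b \<longleftrightarrow>
     \<sigma> \<in> Aut (Suc n) \<and> (\<forall>i\<in>labels. a i \<in> Aut n) \<and> b \<in> Aut 1 \<and>
     (\<forall>i\<in>labels. \<forall>w\<in>verts n. \<sigma> (i # w) = b [i] @ a i w)"

definition sgn2 :: "(nat list \<Rightarrow> nat list) \<Rightarrow> int" where
  "sgn2 \<sigma> = sign (perm_restrict \<sigma> (level 2))"

text \<open>The value at \<open>0\<close> is a convention only; the recursion starts at \<open>1\<close>.\<close>

fun E :: "nat \<Rightarrow> (nat list \<Rightarrow> nat list) set" where
  "E 0 = Aut 0"
| "E (Suc 0) = Aut 1"
| "E (Suc (Suc n)) = {\<sigma> \<in> Aut (Suc (Suc n)).
     (\<exists>a b. wreath_decomp (Suc n) \<sigma> a b \<and> (\<forall>i\<in>labels. a i \<in> E (Suc n))) \<and> sgn2 \<sigma> = 1}"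

definition E_fix :: "nat \<Rightarrow> (nat list \<Rightarrow> nat list) set" where
  "E_fix n = {\<sigma> \<in> E n. \<exists>v\<in>level n. \<sigma> v = v}"

end

theory Submission
  imports Defs
begin

text \<open>
  Let \<open>f\<^sub>n\<close> be the proportion of elements of \<open>E\<^sub>n\<close> that fix a leaf, and \<open>d\<^sub>n\<close> the sum of the
  signs of their root permutations divided by \<open>|E\<^sub>n|\<close>. Since
  \<open>sgn\<^sub>2((a\<^sub>1, a\<^sub>2, a\<^sub>3), b) = sgn(b) \<Prod> sgn(a\<^sub>i)\<close>, with \<open>sgn\<close> the sign on level 1, membership
  in \<open>E\<^sub>n\<close> couples the \<open>a\<^sub>i\<close> and \<open>b\<close> only through signs, and the indicator
  \<open>(1 + sgn(b) \<Prod> sgn(a\<^sub>i)) / 2\<close> turns all counts into products. A leaf is fixed iff some fixed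
  point \<open>i\<close> of \<open>b\<close> has an \<open>a\<^sub>i\<close> that fixes a leaf; summing over the six \<open>b\<close> yields
  \<open>f\<^sub>n\<^sub>+\<^sub>1 = f\<^sub>n - f\<^sub>n\<^sup>2 / 2 + (f\<^sub>n\<^sup>3 + d\<^sub>n\<^sup>3) / 6\<close> with \<open>|d\<^sub>n| \<le> f\<^sub>n\<close>. Hence
  \<open>1 / f\<^sub>n\<^sub>+\<^sub>1 = 1 / f\<^sub>n + 1 / 2 + O(f\<^sub>n)\<close>, which first gives \<open>f\<^sub>n = O(1 / n)\<close> and then, summing
  the error terms, \<open>1 / f\<^sub>n = n / 2 + O(log n)\<close>.
\<close>

subsection \<open>The wreath recursion for automorphisms\<close>

lemma finite_labels [simp]: "finite labels"
  by (simp add: labels_def)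

lemma card_labels [simp]: "card labels = 3"
  by (simp add: labels_def)

lemma verts_iff: "v \<in> verts n \<longleftrightarrow> length v \<le> n \<and> set v \<subseteq> labels"
  by (auto simp: verts_def level_def)

lemma level_iff: "v \<in> level n \<longleftrightarrow> length v = n \<and> set v \<subseteq> labels"
  by (auto simp: level_def)

lemma finite_verts [simp]: "finite (verts n)"
proof -
  have "verts n = {v. set v \<subseteq> labels \<and> length v \<le> n}"
    by (auto simp: verts_iff)
  then show ?thesis
    using finite_lists_length_le[of labels n] by simp
qed

lemma butlast_verts: "v \<in> verts n \<Longrightarrow> butlast v \<in> verts n"
  by (auto simp: verts_iff dest: in_set_butlastD)

lemma adjacent_iff:
  "adjacent v w \<longleftrightarrow> (w \<noteq> [] \<and> butlast w = v) \<or> (v \<noteq> [] \<and> butlast v = w)"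
  unfolding adjacent_def by (metis append_butlast_last_id butlast_snoc snoc_eq_iff_butlast)

text \<open>Trades adjacency for the parent map \<open>butlast\<close>. Going down from the root,
  the image of a child of \<open>u\<close> must be a neighbour of \<open>\<sigma> u\<close>, and
  injectivity excludes the parent of \<open>\<sigma> u\<close>.\<close>

lemma Aut_iff:
  "\<sigma> \<in> Aut n \<longleftrightarrow> \<sigma> permutes verts n \<and>
     (\<forall>v\<in>verts n. length (\<sigma> v) = length v \<and> butlast (\<sigma> v) = \<sigma> (butlast v))"
proof (intro iffI conjI ballI)
  assume A: "\<sigma> \<in> Aut n"
  then have perm: "\<sigma> permutes verts n" and root: "\<sigma> [] = []"
    and adj: "\<And>v w. v \<in> verts n \<Longrightarrow> w \<in> verts n \<Longrightarrow> adjacent (\<sigma> v) (\<sigma> w) \<longleftrightarrow> adjacent v w"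
    by (auto simp: Aut_def)
  show "\<sigma> permutes verts n" by fact
  have "length (\<sigma> v) = length v \<and> butlast (\<sigma> v) = \<sigma> (butlast v)" if "v \<in> verts n" for v
    using that
  proof (induction v rule: rev_induct)
    case Nil
    then show ?case by (simp add: root)
  next
    case (snoc l u)
    have u: "u \<in> verts n"
      using butlast_verts[OF snoc.prems] by simp
    have IH: "length (\<sigma> u) = length u" "butlast (\<sigma> u) = \<sigma> (butlast u)"
      using snoc.IH[OF u] by auto
    have "adjacent (\<sigma> u) (\<sigma> (u @ [l]))"
      using adj[OF u snoc.prems] by (simp add: adjacent_iff)
    then consider "\<sigma> (u @ [l]) \<noteq> []" "butlast (\<sigma> (u @ [l])) = \<sigma> u"
      | "butlast (\<sigma> u) = \<sigma> (u @ [l])"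
      by (auto simp: adjacent_iff)
    then show ?case
    proof cases
      case 1
      have "length (\<sigma> (u @ [l])) = Suc (length u)"
        using 1 IH by (metis length_append_singleton append_butlast_last_id)
      with 1 show ?thesis by simp
    next
      \<comment> \<open>The induction hypothesis makes this vertex the image of
        \<open>butlast u\<close> as well, against injectivity. The default
        \<open>butlast [] = []\<close> lets the argument cover \<open>u = []\<close> too.\<close>
      case 2
      then have "\<sigma> (butlast u) = \<sigma> (u @ [l])"
        using IH by simp
      then have "butlast u = u @ [l]"
        using permutes_inj[OF perm] by (simp add: inj_eq)
      then have "length (butlast u) = length (u @ [l])"
        by simp
      then show ?thesis by simp
    qed
  qed
  then show "length (\<sigma> v) = length v" "butlast (\<sigma> v) = \<sigma> (butlast v)" if "v \<in> verts n" for v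
    using that by auto
next
  assume "\<sigma> permutes verts n \<and>
     (\<forall>v\<in>verts n. length (\<sigma> v) = length v \<and> butlast (\<sigma> v) = \<sigma> (butlast v))"
  then have perm: "\<sigma> permutes verts n"
    and len: "\<And>v. v \<in> verts n \<Longrightarrow> length (\<sigma> v) = length v"
    and bl: "\<And>v. v \<in> verts n \<Longrightarrow> butlast (\<sigma> v) = \<sigma> (butlast v)"
    by auto
  have Nil: "\<sigma> v = [] \<longleftrightarrow> v = []" if "v \<in> verts n" for v
    using len[OF that] by (metis length_0_conv)
  show "\<sigma> \<in> Aut n"
    unfolding Aut_def
    using perm Nil bl permutes_inj[OF perm] by (auto simp: adjacent_iff inj_eq verts_iff[of "[]"])
qed

lemma Aut_permutes: "\<sigma> \<in> Aut n \<Longrightarrow> \<sigma> permutes verts n"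
  by (simp add: Aut_iff)

lemma Aut_in_verts: "\<sigma> \<in> Aut n \<Longrightarrow> v \<in> verts n \<Longrightarrow> \<sigma> v \<in> verts n"
  by (meson Aut_permutes permutes_in_image)

lemma Aut_length: "\<sigma> \<in> Aut n \<Longrightarrow> v \<in> verts n \<Longrightarrow> length (\<sigma> v) = length v"
  by (simp add: Aut_iff)

lemma Aut_Nil: "\<sigma> \<in> Aut n \<Longrightarrow> \<sigma> [] = []"
  by (simp add: Aut_def)

lemma finite_Aut: "finite (Aut n)"
  by (rule finite_subset[OF _ finite_permutations[of "verts n"]]) (auto simp: Aut_iff)

section \<open>Wreath coordinates: root permutation, sections and gluing\<close>

definition root_perm :: "(nat list \<Rightarrow> nat list) \<Rightarrow> nat \<Rightarrow> nat" where
  "root_perm \<sigma> i = (if i \<in> labels then hd (\<sigma> [i]) else i)"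

text \<open>The identity outside \<open>verts n\<close> makes a section a literal member of
  \<open>Aut n\<close>, so that sections can be compared as functions.\<close>

definition section_at :: "nat \<Rightarrow> (nat list \<Rightarrow> nat list) \<Rightarrow> nat \<Rightarrow> nat list \<Rightarrow> nat list" where
  "section_at n \<sigma> i w = (if w \<in> verts n then tl (\<sigma> (i # w)) else w)"

definition glue :: "nat \<Rightarrow> (nat \<Rightarrow> nat) \<Rightarrow> (nat \<Rightarrow> nat list \<Rightarrow> nat list) \<Rightarrow> nat list \<Rightarrow> nat list" where
  "glue n \<pi> a v = (if v \<in> verts (Suc n) \<and> v \<noteq> [] then \<pi> (hd v) # a (hd v) (tl v) else v)"

abbreviation label_perms :: "(nat \<Rightarrow> nat) set" where
  "label_perms \<equiv> {\<pi>. \<pi> permutes labels}"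

lemma glue_Cons: "i \<in> labels \<Longrightarrow> w \<in> verts n \<Longrightarrow> glue n \<pi> a (i # w) = \<pi> i # a i w"
  by (auto simp: glue_def verts_iff)

lemma glue_in_Aut:
  assumes \<pi>: "\<pi> permutes labels" and a: "\<And>i. i \<in> labels \<Longrightarrow> a i \<in> Aut n"
  shows "glue n \<pi> a \<in> Aut (Suc n)"
  unfolding Aut_iff
proof (intro conjI ballI)
  have "bij_betw (glue n \<pi> a) (verts (Suc n)) (verts (Suc n))"
    unfolding bij_betw_def
  proof
    show inj: "inj_on (glue n \<pi> a) (verts (Suc n))"
    proof (rule inj_onI)
      fix v w assume vw: "v \<in> verts (Suc n)" "w \<in> verts (Suc n)" "glue n \<pi> a v = glue n \<pi> a w"
      show "v = w"
      proof (cases "v = [] \<or> w = []")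
        case True
        then show ?thesis using vw by (auto simp: glue_def split: if_splits)
      next
        case False
        then obtain i v' j w' where [simp]: "v = i # v'" "w = j # w'"
          by (meson neq_Nil_conv)
        have ij: "i \<in> labels" "j \<in> labels" "v' \<in> verts n" "w' \<in> verts n"
          using vw by (auto simp: verts_iff)
        then have "\<pi> i = \<pi> j" "a i v' = a j w'"
          using vw(3) by (auto simp: glue_Cons)
        then have "i = j" "v' = w'"
          using permutes_inj[OF \<pi>] permutes_inj[OF Aut_permutes[OF a[OF ij(1)]]]
          by (auto simp: inj_eq)
        then show ?thesis by simp
      qed
    qed
    have "glue n \<pi> a ` verts (Suc n) \<subseteq> verts (Suc n)"
    proof (rule image_subsetI)
      fix v assume v: "v \<in> verts (Suc n)"
      show "glue n \<pi> a v \<in> verts (Suc n)"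
      proof (cases v)
        case Nil
        then show ?thesis by (simp add: glue_def verts_iff)
      next
        case (Cons i w)
        then have iw: "i \<in> labels" "w \<in> verts n"
          using v by (auto simp: verts_iff)
        have "\<pi> i \<in> labels" "a i w \<in> verts n"
          using iw \<pi> a Aut_in_verts by (auto simp: permutes_in_image)
        then show ?thesis
          using Cons iw by (auto simp: glue_Cons verts_iff)
      qed
    qed
    then show "glue n \<pi> a ` verts (Suc n) = verts (Suc n)"
      using inj by (simp add: endo_inj_surj)
  qed
  then show "glue n \<pi> a permutes verts (Suc n)"
    by (rule bij_imp_permutes) (simp add: glue_def)
  fix v assume v: "v \<in> verts (Suc n)"
  show "length (glue n \<pi> a v) = length v"
  proof (cases v)
    case (Cons i w)
    then have "i \<in> labels" "w \<in> verts n"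
      using v by (auto simp: verts_iff)
    then show ?thesis
      using Cons Aut_length[OF a] by (simp add: glue_Cons)
  qed (simp add: glue_def)
  show "butlast (glue n \<pi> a v) = glue n \<pi> a (butlast v)"
  proof (cases v)
    case Nil
    then show ?thesis by (simp add: glue_def)
  next
    case (Cons i w)
    then have iw: "i \<in> labels" "w \<in> verts n"
      using v by (auto simp: verts_iff)
    have "a i w = [] \<longleftrightarrow> w = []"
      using Aut_length[OF a[OF iw(1)] iw(2)] by (metis length_0_conv)
    moreover have "butlast (a i w) = a i (butlast w)"
      using a[OF iw(1)] iw(2) by (simp add: Aut_iff)
    ultimately show ?thesis
      using Cons iw butlast_verts[OF iw(2)] by (auto simp: glue_Cons glue_def[of _ _ _ "[]"])
  qed
qed

text \<open>The first label of an image depends only on the first label of the vertex: passing to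
  the parent commutes with \<open>\<sigma>\<close>, so the last labels can be stripped one by one
  until \<open>[i]\<close> remains.\<close>

lemma Aut_Cons:
  assumes \<sigma>: "\<sigma> \<in> Aut (Suc n)" and i: "i \<in> labels" and w: "w \<in> verts n"
  shows "\<sigma> (i # w) = root_perm \<sigma> i # section_at n \<sigma> i w"
proof -
  have "\<sigma> (i # w) \<noteq> [] \<and> hd (\<sigma> (i # w)) = hd (\<sigma> [i])"
    using w
  proof (induction w rule: rev_induct)
    case Nil
    then show ?case
      using i Aut_length[OF \<sigma>, of "[i]"] by (auto simp: verts_iff)
  next
    case (snoc l u)
    have v: "i # u @ [l] \<in> verts (Suc n)" and u: "u \<in> verts n"
      using snoc.prems i by (auto simp: verts_iff)
    have bl: "butlast (\<sigma> (i # u @ [l])) = \<sigma> (i # u)"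
      using \<sigma> v by (simp add: Aut_iff butlast_append)
    then show ?case
      using snoc.IH[OF u] by (metis butlast.simps(1) hd_append2 append_butlast_last_id)
  qed
  then show ?thesis
    using i w by (simp add: root_perm_def section_at_def) (metis list.collapse)
qed

lemma root_perm_permutes:
  assumes "\<sigma> \<in> Aut (Suc n)"
  shows "root_perm \<sigma> permutes labels"
proof -
  have sing: "\<sigma> [i] = [root_perm \<sigma> i] \<and> root_perm \<sigma> i \<in> labels" if "i \<in> labels" for i
  proof -
    have i: "[i] \<in> verts (Suc n)"
      using that by (simp add: verts_iff)
    have "length (\<sigma> [i]) = 1" "\<sigma> [i] \<in> verts (Suc n)"
      using Aut_length[OF assms i] Aut_in_verts[OF assms i] by auto
    then show ?thesis
      using that by (cases "\<sigma> [i]") (auto simp: root_perm_def verts_iff)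
  qed
  have inj: "inj_on (root_perm \<sigma>) labels"
  proof (rule inj_onI)
    fix i j assume "i \<in> labels" "j \<in> labels" "root_perm \<sigma> i = root_perm \<sigma> j"
    then have "\<sigma> [i] = \<sigma> [j]" using sing by metis
    then show "i = j"
      using permutes_inj[OF Aut_permutes[OF assms]] by (simp add: inj_eq)
  qed
  show ?thesis
  proof (rule bij_imp_permutes)
    show "bij_betw (root_perm \<sigma>) labels labels"
      unfolding bij_betw_def using inj sing by (meson endo_inj_surj finite_labels image_subsetI)
  qed (simp add: root_perm_def)
qed

lemma section_at_in_Aut:
  assumes \<sigma>: "\<sigma> \<in> Aut (Suc n)" and i: "i \<in> labels"
  shows "section_at n \<sigma> i \<in> Aut n"
  unfolding Aut_iff
proof (intro conjI ballI)
  have Cons_verts: "i # w \<in> verts (Suc n)" if "w \<in> verts n" for w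
    using that i by (simp add: verts_iff)
  have inj: "inj_on (section_at n \<sigma> i) (verts n)"
  proof (rule inj_onI)
    fix v w assume "v \<in> verts n" "w \<in> verts n" "section_at n \<sigma> i v = section_at n \<sigma> i w"
    then have "\<sigma> (i # v) = \<sigma> (i # w)"
      using Aut_Cons[OF \<sigma> i] by simp
    then show "v = w"
      using permutes_inj[OF Aut_permutes[OF \<sigma>]] by (simp add: inj_eq)
  qed
  have "section_at n \<sigma> i w \<in> verts n" if "w \<in> verts n" for w
    using Aut_in_verts[OF \<sigma> Cons_verts[OF that]] Aut_Cons[OF \<sigma> i that]
    by (simp add: verts_iff)
  then have "section_at n \<sigma> i ` verts n = verts n"
    using inj by (intro endo_inj_surj) auto
  then show "section_at n \<sigma> i permutes verts n"
    using inj by (intro bij_imp_permutes) (auto simp: bij_betw_def section_at_def)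
  fix w assume w: "w \<in> verts n"
  show "length (section_at n \<sigma> i w) = length w"
    using Aut_length[OF \<sigma> Cons_verts[OF w]] Aut_Cons[OF \<sigma> i w] by simp
  show "butlast (section_at n \<sigma> i w) = section_at n \<sigma> i (butlast w)"
  proof (cases "w = []")
    case True
    then show ?thesis
      using Aut_length[OF \<sigma> Cons_verts[OF w]] w
      by (cases "\<sigma> [i]") (auto simp: section_at_def)
  next
    case False
    then have "butlast (\<sigma> (i # w)) = \<sigma> (i # butlast w)"
      using \<sigma> Cons_verts[OF w] by (simp add: Aut_iff)
    then show ?thesis
      using w butlast_verts[OF w] by (simp add: section_at_def butlast_tl)
  qed
qed

lemma root_perm_glue:
  assumes "\<pi> permutes labels"
  shows "root_perm (glue n \<pi> a) = \<pi>"
proof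
  fix i show "root_perm (glue n \<pi> a) i = \<pi> i"
    using assms by (auto simp: root_perm_def glue_Cons verts_iff permutes_not_in)
qed

lemma section_at_glue:
  assumes "a i \<in> Aut n" "i \<in> labels"
  shows "section_at n (glue n \<pi> a) i = a i"
proof
  fix w show "section_at n (glue n \<pi> a) i w = a i w"
    using assms permutes_not_in[OF Aut_permutes[OF assms(1)]]
    by (auto simp: section_at_def glue_Cons)
qed

lemma glue_root_perm_section_at:
  assumes \<sigma>: "\<sigma> \<in> Aut (Suc n)"
  shows "glue n (root_perm \<sigma>) (restrict (section_at n \<sigma>) labels) = \<sigma>"
proof
  fix v
  show "glue n (root_perm \<sigma>) (restrict (section_at n \<sigma>) labels) v = \<sigma> v"
  proof (cases "v \<in> verts (Suc n) \<and> v \<noteq> []")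
    case True
    then obtain i w where "v = i # w" "i \<in> labels" "w \<in> verts n"
      by (cases v) (auto simp: verts_iff)
    then show ?thesis
      using Aut_Cons[OF \<sigma>] by (simp add: glue_Cons)
  next
    case False
    then show ?thesis
      using permutes_not_in[OF Aut_permutes[OF \<sigma>]] Aut_Nil[OF \<sigma>]
      by (auto simp: glue_def)
  qed
qed

text \<open>The wreath product identification in the form used for counting. Extensional functions
  on \<open>labels\<close> represent each triple of sections exactly once.\<close>

lemma bij_betw_glue:
  "bij_betw (\<lambda>(\<pi>, a). glue n \<pi> a) (label_perms \<times> (labels \<rightarrow>\<^sub>E Aut n)) (Aut (Suc n))"
proof (rule bij_betw_byWitness[where f' = "\<lambda>\<sigma>. (root_perm \<sigma>, restrict (section_at n \<sigma>) labels)"])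
  show "\<forall>x\<in>label_perms \<times> (labels \<rightarrow>\<^sub>E Aut n).
      (\<lambda>\<sigma>. (root_perm \<sigma>, restrict (section_at n \<sigma>) labels)) ((\<lambda>(\<pi>, a). glue n \<pi> a) x) = x"
    by (auto simp: root_perm_glue section_at_glue fun_eq_iff PiE_iff restrict_def extensional_def)
  show "\<forall>\<sigma>\<in>Aut (Suc n). (\<lambda>(\<pi>, a). glue n \<pi> a)
      ((\<lambda>\<sigma>. (root_perm \<sigma>, restrict (section_at n \<sigma>) labels)) \<sigma>) = \<sigma>"
    by (simp add: glue_root_perm_section_at)
qed (auto simp: root_perm_permutes section_at_in_Aut intro!: glue_in_Aut)

text \<open>A decomposition is unique on \<open>labels\<close>: \<open>b [i]\<close> has length 1,
  so \<open>tl\<close> removes exactly it and leaves \<open>a i\<close>. The existential in the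
  recursion for \<open>E\<close> thereby becomes a condition on the sections.\<close>

lemma wreath_decomp_iff:
  "(\<exists>b. wreath_decomp n \<sigma> a b) \<longleftrightarrow>
     \<sigma> \<in> Aut (Suc n) \<and> (\<forall>i\<in>labels. a i = section_at n \<sigma> i)"
proof safe
  fix b i assume wd: "wreath_decomp n \<sigma> a b" and i: "i \<in> labels"
  then have a: "a i \<in> Aut n" and \<sigma>: "\<And>w. w \<in> verts n \<Longrightarrow> \<sigma> (i # w) = b [i] @ a i w"
    and b: "b \<in> Aut 1"
    by (auto simp: wreath_decomp_def)
  have "length (b [i]) = 1"
    using Aut_length[OF b, of "[i]"] i by (simp add: verts_iff)
  then obtain c where "b [i] = [c]"
    by (auto simp: length_Suc_conv)
  then show "a i = section_at n \<sigma> i"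
    using \<sigma> permutes_not_in[OF Aut_permutes[OF a]] by (auto simp: section_at_def fun_eq_iff)
next
  assume \<sigma>: "\<sigma> \<in> Aut (Suc n)" and a: "\<forall>i\<in>labels. a i = section_at n \<sigma> i"
  \<comment> \<open>\<open>Aut 1\<close> is reached by gluing over the trivial
    \<open>Aut 0\<close>.\<close>
  define b where "b = glue 0 (root_perm \<sigma>) (\<lambda>i. id)"
  have id: "id \<in> Aut 0"
    by (simp add: Aut_def permutes_id)
  have "b \<in> Aut 1"
    using glue_in_Aut[OF root_perm_permutes[OF \<sigma>], of "\<lambda>i. id" 0] id by (simp add: b_def)
  moreover have "b [i] = [root_perm \<sigma> i]" if "i \<in> labels" for i
    using that by (simp add: b_def glue_Cons verts_iff)
  ultimately have "wreath_decomp n \<sigma> a b"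
    using \<sigma> a Aut_Cons[OF \<sigma>] section_at_in_Aut[OF \<sigma>] by (simp add: wreath_decomp_def)
  then show "\<exists>b. wreath_decomp n \<sigma> a b" by blast
qed (auto simp: wreath_decomp_def)

subsection \<open>The sign on level 2\<close>

text \<open>Writing a row permutation as a \<open>map_permutation\<close> gives its sign at once;
  this pointwise form is for computing composites. Off the image of the row the two sides agree
  because \<open>p\<close> fixes everything outside \<open>A\<close>.\<close>

lemma map_permutation_row:
  assumes "p permutes A"
  shows "map_permutation A (\<lambda>j. [i, j]) p x =
    (case x of [k, j] \<Rightarrow> if k = i then [k, p j] else x | _ \<Rightarrow> x)"
proof (cases "x \<in> (\<lambda>j. [i, j]) ` A")
  case True
  then obtain j where j: "x = [i, j]" "j \<in> A" by auto
  show ?thesis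
    unfolding j(1) using map_permutation_apply[of "\<lambda>j. [i, j]" A j p] j(2)
    by (simp add: inj_on_def)
next
  case False
  then have "map_permutation A (\<lambda>j. [i, j]) p x = x"
    by (simp add: map_permutation_def)
  with False show ?thesis
    using permutes_not_in[OF assms, symmetric] by (auto split: list.splits)
qed

lemma map_permutation_column:
  assumes "p permutes A"
  shows "map_permutation A (\<lambda>i. [i, j]) p x =
    (case x of [i, k] \<Rightarrow> if k = j then [p i, k] else x | _ \<Rightarrow> x)"
proof (cases "x \<in> (\<lambda>i. [i, j]) ` A")
  case True
  then obtain i where i: "x = [i, j]" "i \<in> A" by auto
  show ?thesis
    unfolding i(1) using map_permutation_apply[of "\<lambda>i. [i, j]" A i p] i(2)
    by (simp add: inj_on_def)
next
  case False
  then have "map_permutation A (\<lambda>i. [i, j]) p x = x"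
    by (simp add: map_permutation_def)
  with False show ?thesis
    using permutes_not_in[OF assms, symmetric] by (auto split: list.splits)
qed

text \<open>
  On the \<open>3 \<times> 3\<close> grid of level 2, the element \<open>((a\<^sub>1, a\<^sub>2, a\<^sub>3), b)\<close> permutes each row \<open>i\<close> by
  \<open>a\<^sub>i\<close> and then each of the three columns by \<open>b\<close>; the factor \<open>sgn(b)\<^sup>3\<close> is \<open>sgn(b)\<close>.
\<close>

lemma sgn2_glue:
  assumes \<pi>: "\<pi> permutes labels" and a: "\<And>i. i \<in> labels \<Longrightarrow> a i \<in> Aut (Suc n)"
  shows "sgn2 (glue (Suc n) \<pi> a) = sign \<pi> * (\<Prod>i\<in>labels. sign (root_perm (a i)))"
proof -
  define row where "row i = map_permutation labels (\<lambda>j. [i, j]) (root_perm (a i))" for i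
  define col where "col j = map_permutation labels (\<lambda>i. [i, j]) \<pi>" for j
  have \<rho>: "root_perm (a i) permutes labels" if "i \<in> labels" for i
    using root_perm_permutes[OF a[OF that]] .
  have inj: "inj_on (\<lambda>j. [i, j]) labels" "inj_on (\<lambda>i. [i, j]) labels" for i j
    by (auto simp: inj_on_def)
  have row: "permutation (row i)" "sign (row i) = sign (root_perm (a i))" if "i \<in> labels" for i
    unfolding row_def using \<rho>[OF that] inj
    by (auto simp: permutation_permutes sign_map_permutation inj_on_imp_bij_betw
        intro!: exI[of _ "(\<lambda>j. [i, j]) ` labels"] map_permutation_permutes)
  have col: "permutation (col j)" "sign (col j) = sign \<pi>" for j
    unfolding col_def using \<pi> inj
    by (auto simp: permutation_permutes sign_map_permutation inj_on_imp_bij_betw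
        intro!: exI[of _ "(\<lambda>i. [i, j]) ` labels"] map_permutation_permutes)
  have lab: "1 \<in> labels" "2 \<in> labels" "3 \<in> labels"
    by (auto simp: labels_def)
  \<comment> \<open>Rows act first, on the rightmost side. A point of row \<open>i\<close> is moved
    only by \<open>row i\<close>, and afterwards only by the column into which it has been
    carried.\<close>
  have "perm_restrict (glue (Suc n) \<pi> a) (level 2) =
      col 1 \<circ> col 2 \<circ> col 3 \<circ> row 1 \<circ> row 2 \<circ> row 3" (is "?l = ?r")
  proof
    fix x
    show "?l x = ?r x"
    proof (cases "\<exists>i j. x = [i, j]")
      case False
      then have "row k x = x" if "k \<in> labels" for k
        unfolding row_def map_permutation_row[OF \<rho>[OF that]] by (auto split: list.splits)
      moreover have "col k x = x" for k
        unfolding col_def map_permutation_column[OF \<pi>] using False by (auto split: list.splits)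
      moreover have "x \<notin> level 2"
        using False by (auto simp: level_iff length_Suc_conv numeral_2_eq_2)
      ultimately show ?thesis
        using lab by (simp add: perm_restrict_def)
    next
      case True
      then obtain i j where x: "x = [i, j]" by auto
      have R: "row k [k', l] = (if k' = k then [k', root_perm (a k) l] else [k', l])"
        if "k \<in> labels" for k k' l
        unfolding row_def map_permutation_row[OF \<rho>[OF that]] by simp
      have C: "col k [l, k'] = (if k' = k then [\<pi> l, k'] else [l, k'])" for k k' l
        unfolding col_def map_permutation_column[OF \<pi>] by simp
      have r: "?r [i, j] = [\<pi> i, root_perm (a i) j]" if "i \<in> labels" "j \<in> labels"
      proof -
        have "root_perm (a i) j \<in> labels"
          using that by (simp add: permutes_in_image[OF \<rho>])
        then show ?thesis
          using that(1) lab by (auto simp: R C labels_def)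
      qed
      have l: "?l [i, j] = [\<pi> i, root_perm (a i) j]" if ij: "i \<in> labels" "j \<in> labels"
      proof -
        have "a i [j] = [root_perm (a i) j]"
          using Aut_Cons[OF a[OF ij(1)] ij(2), of "[]"] Aut_length[OF a[OF ij(1)], of "[j]"] ij(2)
          by (simp add: verts_iff)
        then show ?thesis
          using ij by (simp add: perm_restrict_def level_iff glue_Cons verts_iff)
      qed
      \<comment> \<open>Equality is needed at all two-element lists, also off the grid. There no
        column matches \<open>j\<close>, or no row matches \<open>i\<close> and \<open>\<pi>\<close>
        fixes \<open>i\<close>.\<close>
      have r': "?r [i, j] = [i, j]" if "i \<notin> labels \<or> j \<notin> labels"
      proof (cases "i \<in> labels")
        case True
        then have "root_perm (a i) j = j" "j \<notin> labels"
          using that by (auto simp: permutes_not_in[OF \<rho>])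
        then show ?thesis
          using lab by (auto simp: R C labels_def)
      next
        case False
        then have "\<pi> i = i"
          using permutes_not_in[OF \<pi>] by simp
        moreover have "i \<noteq> 1" "i \<noteq> 2" "i \<noteq> 3"
          using False lab by auto
        ultimately show ?thesis
          using lab by (simp add: R C)
      qed
      have l': "?l [i, j] = [i, j]" if "i \<notin> labels \<or> j \<notin> labels"
        using that by (auto simp: perm_restrict_def level_iff)
      show ?thesis
        unfolding x using r l r' l' by (cases "i \<in> labels \<and> j \<in> labels") (metis, metis)
    qed
  qed
  then have "sgn2 (glue (Suc n) \<pi> a) = sign \<pi> * sign \<pi> * sign \<pi> *
      (sign (root_perm (a 1)) * sign (root_perm (a 2)) * sign (root_perm (a 3)))"
    unfolding sgn2_def using row lab col
    by (simp add: sign_compose permutation_compose)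
  then show ?thesis
    by (simp add: labels_def sign_idempotent mult.assoc)
qed

section \<open>The groups \<open>E n\<close> in wreath coordinates\<close>

abbreviation root_sign :: "(nat list \<Rightarrow> nat list) \<Rightarrow> int" where
  "root_sign \<sigma> \<equiv> sign (root_perm \<sigma>)"

lemma E_subset_Aut: "E n \<subseteq> Aut n"
  by (cases n rule: E.cases) auto

lemma finite_E: "finite (E n)"
  using finite_subset[OF E_subset_Aut finite_Aut] .

lemma E_fix_subset: "E_fix n \<subseteq> E n"
  by (auto simp: E_fix_def)

text \<open>By \<open>sgn2_glue\<close> the condition \<open>sgn2 \<sigma> = 1\<close> says that the
  product of the root signs of the sections equals \<open>sign \<pi>\<close>, since signs are their
  own inverses. The admissible triples thus depend on \<open>\<pi>\<close>, whence the dependent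
  sum.\<close>

lemma bij_betw_glue_E:
  "bij_betw (\<lambda>(\<pi>, a). glue (Suc n) \<pi> a)
    (SIGMA \<pi>:label_perms. {a \<in> labels \<rightarrow>\<^sub>E E (Suc n). (\<Prod>i\<in>labels. root_sign (a i)) = sign \<pi>})
    (E (Suc (Suc n)))"
proof -
  let ?g = "\<lambda>(\<pi>, a). glue (Suc n) \<pi> a"
  let ?S = "SIGMA \<pi>:label_perms. {a \<in> labels \<rightarrow>\<^sub>E E (Suc n). (\<Prod>i\<in>labels. root_sign (a i)) = sign \<pi>}"
  have E: "\<sigma> \<in> E (Suc (Suc n)) \<longleftrightarrow> \<sigma> \<in> Aut (Suc (Suc n)) \<and>
      (\<forall>i\<in>labels. section_at (Suc n) \<sigma> i \<in> E (Suc n)) \<and> sgn2 \<sigma> = 1" for \<sigma>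
  proof -
    have "(\<exists>a b. wreath_decomp (Suc n) \<sigma> a b \<and> (\<forall>i\<in>labels. a i \<in> E (Suc n))) \<longleftrightarrow>
        (\<exists>a. (\<exists>b. wreath_decomp (Suc n) \<sigma> a b) \<and> (\<forall>i\<in>labels. a i \<in> E (Suc n)))"
      by blast
    also have "\<dots> \<longleftrightarrow> \<sigma> \<in> Aut (Suc (Suc n)) \<and> (\<forall>i\<in>labels. section_at (Suc n) \<sigma> i \<in> E (Suc n))"
      unfolding wreath_decomp_iff by auto
    finally show ?thesis by auto
  qed
  have glue_E: "glue (Suc n) \<pi> a \<in> E (Suc (Suc n)) \<longleftrightarrow>
      (\<forall>i\<in>labels. a i \<in> E (Suc n)) \<and> (\<Prod>i\<in>labels. root_sign (a i)) = sign \<pi>"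
    if "\<pi> permutes labels" "\<And>i. i \<in> labels \<Longrightarrow> a i \<in> Aut (Suc n)" for \<pi> a
  proof -
    have "sign \<pi> * t = 1 \<longleftrightarrow> t = sign \<pi>" for t
      by (cases \<pi> rule: sign_cases) auto
    then show ?thesis
      using that unfolding E by (simp add: glue_in_Aut section_at_glue sgn2_glue)
  qed
  have "?S \<subseteq> label_perms \<times> (labels \<rightarrow>\<^sub>E Aut (Suc n))"
    using E_subset_Aut by (fastforce simp: PiE_iff)
  moreover have "?g ` ?S = E (Suc (Suc n))"
  proof safe
    fix \<pi> a assume "\<pi> permutes labels" "a \<in> labels \<rightarrow>\<^sub>E E (Suc n)"
      "(\<Prod>i\<in>labels. root_sign (a i)) = sign \<pi>"
    then show "glue (Suc n) \<pi> a \<in> E (Suc (Suc n))"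
      using E_subset_Aut by (subst glue_E) (auto simp: PiE_iff)
  next
    fix \<sigma> assume \<sigma>: "\<sigma> \<in> E (Suc (Suc n))"
    then have "\<sigma> \<in> ?g ` (label_perms \<times> (labels \<rightarrow>\<^sub>E Aut (Suc n)))"
      using bij_betw_imp_surj_on[OF bij_betw_glue] E_subset_Aut by blast
    then obtain \<pi> a where "\<pi> permutes labels" "a \<in> labels \<rightarrow>\<^sub>E Aut (Suc n)" "\<sigma> = glue (Suc n) \<pi> a"
      by auto
    moreover from this have "(\<forall>i\<in>labels. a i \<in> E (Suc n)) \<and> (\<Prod>i\<in>labels. root_sign (a i)) = sign \<pi>"
      using \<sigma> glue_E[of \<pi> a] by (simp add: PiE_iff del: E.simps)
    ultimately have "(\<pi>, a) \<in> ?S"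
      by (auto simp: PiE_iff)
    then show "\<sigma> \<in> ?g ` ?S"
      using \<open>\<sigma> = _\<close> by (force intro: rev_image_eqI)
  qed
  ultimately show ?thesis
    using bij_betw_subset[OF bij_betw_glue] by auto
qed

lemma glue_fixes_leaf_iff:
  "(\<exists>v\<in>level (Suc n). glue n \<pi> a v = v) \<longleftrightarrow> (\<exists>i\<in>labels. \<pi> i = i \<and> (\<exists>w\<in>level n. a i w = w))"
proof
  assume "\<exists>v\<in>level (Suc n). glue n \<pi> a v = v"
  then obtain i w where "i \<in> labels" "w \<in> level n" "glue n \<pi> a (i # w) = i # w"
    by (auto simp: level_iff length_Suc_conv)
  then show "\<exists>i\<in>labels. \<pi> i = i \<and> (\<exists>w\<in>level n. a i w = w)"
    by (auto simp: glue_Cons level_iff verts_iff intro!: bexI[of _ i] bexI[of _ w])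
next
  assume "\<exists>i\<in>labels. \<pi> i = i \<and> (\<exists>w\<in>level n. a i w = w)"
  then obtain i w where "i \<in> labels" "w \<in> level n" "\<pi> i = i" "a i w = w"
    by auto
  then have "i # w \<in> level (Suc n)" "glue n \<pi> a (i # w) = i # w"
    by (auto simp: glue_Cons level_iff verts_iff)
  then show "\<exists>v\<in>level (Suc n). glue n \<pi> a v = v" ..
qed

subsection \<open>Counting by signs\<close>

text \<open>Twice the indicator of the event that a product \<open>t\<close> of signs equals
  \<open>s\<close> is \<open>1 + s * t\<close>. Summed over the box, the first term gives its size
  and the second factorizes by the distributive law \<open>prod_sum_PiE\<close>.\<close>

lemma card_PiE_prod_sign:
  fixes \<chi> :: "'b \<Rightarrow> int"
  assumes fin: "finite I" "\<And>i. i \<in> I \<Longrightarrow> finite (Y i)"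
    and \<chi>: "\<And>y. \<chi> y = 1 \<or> \<chi> y = - 1" and s: "s = 1 \<or> s = - 1"
  shows "2 * int (card {a \<in> PiE I Y. (\<Prod>i\<in>I. \<chi> (a i)) = s}) =
    (\<Prod>i\<in>I. int (card (Y i))) + s * (\<Prod>i\<in>I. \<Sum>y\<in>Y i. \<chi> y)"
proof -
  have pm: "(\<Prod>i\<in>I. \<chi> (a i)) = 1 \<or> (\<Prod>i\<in>I. \<chi> (a i)) = - 1" for a
    using fin(1)
  proof induction
    case (insert x F)
    then show ?case using \<chi>[of "a x"] by auto
  qed simp
  have finP: "finite (PiE I Y)"
    using fin by (rule finite_PiE)
  have "2 * int (card {a \<in> PiE I Y. (\<Prod>i\<in>I. \<chi> (a i)) = s}) =
      (\<Sum>a\<in>PiE I Y. if (\<Prod>i\<in>I. \<chi> (a i)) = s then 2 else 0)"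
    using finP by (simp add: sum.If_cases Int_def)
  also have "\<dots> = (\<Sum>a\<in>PiE I Y. 1 + s * (\<Prod>i\<in>I. \<chi> (a i)))"
    using pm s by (intro sum.cong) fastforce+
  also have "\<dots> = int (card (PiE I Y)) + s * (\<Prod>i\<in>I. \<Sum>y\<in>Y i. \<chi> y)"
    by (simp add: sum.distrib sum_distrib_left prod_sum_PiE[OF fin])
  also have "int (card (PiE I Y)) = (\<Prod>i\<in>I. int (card (Y i)))"
    using fin by (simp add: card_PiE)
  finally show ?thesis .
qed

lemma sum_label_perms:
  "(\<Sum>\<pi>\<in>label_perms. f \<pi>) =
    f id + f (transpose 2 3) + (f (transpose 1 2) + f (transpose 1 2 \<circ> transpose 2 3)) +
    (f (transpose 1 3) + f (transpose 1 3 \<circ> transpose 2 3))"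
  unfolding labels_def
  by (simp add: sum_over_permutations_insert add.assoc del: One_nat_def)

text \<open>The identity contributes \<open>a ^ 3\<close>, each of the three transpositions has one
  fixed point and contributes \<open>a * b\<^sup>2\<close>, and each of the two 3-cycles contributes
  \<open>b ^ 3\<close>. With signs only the transpositions change.\<close>

lemma sum_prod_fixed_points:
  fixes a b :: int
  shows "(\<Sum>\<pi>\<in>label_perms. \<Prod>i\<in>labels. if \<pi> i = i then a else b) = a ^ 3 + 3 * a * b\<^sup>2 + 2 * b ^ 3"
    and "(\<Sum>\<pi>\<in>label_perms. sign \<pi> * (\<Prod>i\<in>labels. if \<pi> i = i then a else b)) =
      a ^ 3 - 3 * a * b\<^sup>2 + 2 * b ^ 3"
proof -
  have P: "(\<Prod>i\<in>labels. if \<pi> i = i then a else b) =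
      (if \<pi> 1 = 1 then a else b) * ((if \<pi> 2 = 2 then a else b) * (if \<pi> 3 = 3 then a else b))"
    for \<pi> :: "nat \<Rightarrow> nat"
    by (simp add: labels_def)
  show "(\<Sum>\<pi>\<in>label_perms. \<Prod>i\<in>labels. if \<pi> i = i then a else b) = a ^ 3 + 3 * a * b\<^sup>2 + 2 * b ^ 3"
    unfolding sum_label_perms P
    by (simp add: transpose_def power2_eq_square power3_eq_cube)
  show "(\<Sum>\<pi>\<in>label_perms. sign \<pi> * (\<Prod>i\<in>labels. if \<pi> i = i then a else b)) =
      a ^ 3 - 3 * a * b\<^sup>2 + 2 * b ^ 3"
    unfolding sum_label_perms P sign_compose[OF permutation_swap_id permutation_swap_id]
      sign_swap_id sign_id
    by (simp add: transpose_def power2_eq_square power3_eq_cube)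
qed

text \<open>One step of the recursion. Elements without a fixed leaf are the ones counted, because
  for given \<open>\<pi>\<close> they impose independent conditions on the three sections. Balance
  of root signs is both assumed and reproduced, so the step can be iterated.\<close>

lemma E_Suc_Suc_counts:
  fixes n :: nat
  defines "X \<equiv> E (Suc n)" and "F \<equiv> E_fix (Suc n)"
  defines "e \<equiv> int (card X)" and "\<phi> \<equiv> int (card F)" and "\<delta> \<equiv> \<Sum>\<sigma>\<in>F. root_sign \<sigma>"
  assumes balanced: "(\<Sum>\<sigma>\<in>X. root_sign \<sigma>) = 0"
  shows card_E_Suc_Suc: "int (card (E (Suc (Suc n)))) = 3 * e ^ 3"
    and sum_root_sign_E_Suc_Suc: "(\<Sum>\<sigma>\<in>E (Suc (Suc n)). root_sign \<sigma>) = 0"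
    and card_E_fix_Suc_Suc:
      "2 * int (card (E_fix (Suc (Suc n)))) = 3 * e\<^sup>2 * \<phi> + e ^ 3 - (e - \<phi>) ^ 3 + \<delta> ^ 3"
proof -
  define C where "C \<pi> Y = {a \<in> PiE labels Y. (\<Prod>i\<in>labels. root_sign (a i)) = sign \<pi>}"
    for \<pi> :: "nat \<Rightarrow> nat" and Y
  \<comment> \<open>The sections allowed when no leaf is fixed: only those over fixed points of
    \<open>\<pi>\<close> are constrained.\<close>
  define Y where "Y \<pi> i = (if \<pi> i = i then X - F else X)" for \<pi> :: "nat \<Rightarrow> nat" and i
  let ?g = "\<lambda>(\<pi>, a). glue (Suc n) \<pi> a"
  have finX: "finite X" and FX: "F \<subseteq> X" and finF: "finite F"
    unfolding X_def F_def using finite_E E_fix_subset by (auto intro: finite_subset)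
  have fin_perms: "finite label_perms"
    by (simp add: finite_permutations)
  have finC: "finite (C \<pi> Z)" if "\<And>i. Z i \<subseteq> X" for \<pi> Z
  proof (rule finite_subset)
    show "finite (PiE labels Z)"
      using finX that by (intro finite_PiE) (auto intro: finite_subset)
  qed (auto simp: C_def)
  have bij: "bij_betw ?g (SIGMA \<pi>:label_perms. C \<pi> (\<lambda>_. X)) (E (Suc (Suc n)))"
    using bij_betw_glue_E[of n] by (simp only: C_def X_def)
  have sum_perms: "(\<Sum>\<pi>\<in>label_perms. f \<pi>) = f id + f (transpose 2 3) +
      (f (transpose 1 2) + f (transpose 1 2 \<circ> transpose 2 3)) +
      (f (transpose 1 3) + f (transpose 1 3 \<circ> transpose 2 3))" for f :: "_ \<Rightarrow> int"
    by (rule sum_label_perms)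
  have card_C: "2 * int (card (C \<pi> Z)) =
      (\<Prod>i\<in>labels. int (card (Z i))) + sign \<pi> * (\<Prod>i\<in>labels. \<Sum>\<sigma>\<in>Z i. root_sign \<sigma>)"
    if "\<And>i. Z i \<subseteq> X" for \<pi> Z
    unfolding C_def
    by (rule card_PiE_prod_sign) (use finX that in \<open>auto intro: finite_subset simp: sign_def\<close>)
  \<comment> \<open>Balance kills the sign term, so every \<open>\<pi>\<close> admits exactly half
    of all triples.\<close>
  have card_CX: "2 * int (card (C \<pi> (\<lambda>_. X))) = e ^ 3" for \<pi>
    by (simp add: card_C balanced e_def labels_def power3_eq_cube)
  have "2 * int (card (E (Suc (Suc n)))) = (\<Sum>\<pi>\<in>label_perms. 2 * int (card (C \<pi> (\<lambda>_. X))))"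
    using finC[of "\<lambda>_. X"] fin_perms unfolding bij_betw_same_card[OF bij, symmetric]
    by (simp add: card_SigmaI sum_distrib_left)
  also have "\<dots> = 6 * e ^ 3"
    unfolding card_CX sum_perms by simp
  finally show "int (card (E (Suc (Suc n)))) = 3 * e ^ 3" by simp
  \<comment> \<open>The root sign of a glued element is \<open>sign \<pi>\<close>. All
    \<open>\<pi>\<close> have equally many admissible triples, so the sum is a multiple of the sum
    of signs over the symmetric group on three labels, which is 0.\<close>
  have "(\<Sum>\<sigma>\<in>E (Suc (Suc n)). root_sign \<sigma>) =
      (\<Sum>x\<in>(SIGMA \<pi>:label_perms. C \<pi> (\<lambda>_. X)). root_sign (?g x))"
    by (rule sum.reindex_bij_betw[OF bij, symmetric])
  also have "\<dots> = (\<Sum>(\<pi>, a)\<in>(SIGMA \<pi>:label_perms. C \<pi> (\<lambda>_. X)). sign \<pi>)"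
    by (intro sum.cong) (auto simp: root_perm_glue)
  also have "\<dots> = (\<Sum>\<pi>\<in>label_perms. sign \<pi> * int (card (C \<pi> (\<lambda>_. X))))"
    using finC[of "\<lambda>_. X"] fin_perms
    by (subst sum.Sigma[symmetric]) (auto simp: mult.commute)
  finally have "2 * (\<Sum>\<sigma>\<in>E (Suc (Suc n)). root_sign \<sigma>) =
      (\<Sum>\<pi>\<in>label_perms. sign \<pi> * (2 * int (card (C \<pi> (\<lambda>_. X)))))"
    by (simp add: sum_distrib_left mult.left_commute del: E.simps)
  also have "\<dots> = 0"
    unfolding card_CX sum_perms by (simp add: sign_compose sign_swap_id permutation_swap_id)
  finally show "(\<Sum>\<sigma>\<in>E (Suc (Suc n)). root_sign \<sigma>) = 0" by simp
  have F_iff: "a i \<in> F \<longleftrightarrow> (\<exists>w\<in>level (Suc n). a i w = w)" if "a i \<in> X" for a and i :: nat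
    using that by (simp add: F_def X_def E_fix_def)
  have Y: "Y \<pi> i \<subseteq> X" for \<pi> i
    by (simp add: Y_def)
  have CY: "{a \<in> C \<pi> (\<lambda>_. X). \<not> (\<exists>v\<in>level (Suc (Suc n)). glue (Suc n) \<pi> a v = v)} = C \<pi> (Y \<pi>)" for \<pi>
  proof -
    have "\<not> (\<exists>i\<in>labels. \<pi> i = i \<and> (\<exists>w\<in>level (Suc n). a i w = w)) \<longleftrightarrow> (\<forall>i\<in>labels. a i \<in> Y \<pi> i)"
      if "a \<in> labels \<rightarrow>\<^sub>E X" for a
      using that F_iff by (auto simp: Y_def PiE_iff)
    moreover have "C \<pi> (Y \<pi>) = {a \<in> C \<pi> (\<lambda>_. X). \<forall>i\<in>labels. a i \<in> Y \<pi> i}"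
      unfolding C_def using Y by (auto simp: PiE_iff)
    ultimately show ?thesis
      unfolding glue_fixes_leaf_iff by (auto simp: C_def)
  qed
  let ?S = "SIGMA \<pi>:label_perms. C \<pi> (\<lambda>_. X) - C \<pi> (Y \<pi>)"
  have "?S = {x \<in> SIGMA \<pi>:label_perms. C \<pi> (\<lambda>_. X). \<exists>v\<in>level (Suc (Suc n)). ?g x v = v}"
    unfolding CY[symmetric] by auto
  then have image: "?g ` ?S = E_fix (Suc (Suc n))"
    unfolding E_fix_def bij_betw_imp_surj_on[OF bij, symmetric] by auto
  have inj: "inj_on ?g ?S"
    by (rule inj_on_subset[OF bij_betw_imp_inj_on[OF bij]]) auto
  have "card (E_fix (Suc (Suc n))) = card ?S"
    unfolding image[symmetric] by (rule card_image[OF inj])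
  also have "\<dots> = (\<Sum>\<pi>\<in>label_perms. card (C \<pi> (\<lambda>_. X) - C \<pi> (Y \<pi>)))"
    using finC[of "\<lambda>_. X"] fin_perms by (simp add: card_SigmaI)
  also have "int \<dots> = (\<Sum>\<pi>\<in>label_perms. int (card (C \<pi> (\<lambda>_. X))) - int (card (C \<pi> (Y \<pi>))))"
    unfolding of_nat_sum
  proof (intro sum.cong refl)
    fix \<pi> :: "nat \<Rightarrow> nat"
    have "C \<pi> (Y \<pi>) \<subseteq> C \<pi> (\<lambda>_. X)"
      unfolding CY[symmetric] by auto
    then show "int (card (C \<pi> (\<lambda>_. X) - C \<pi> (Y \<pi>))) =
        int (card (C \<pi> (\<lambda>_. X))) - int (card (C \<pi> (Y \<pi>)))"
      using finC[of "Y \<pi>" \<pi>, OF Y] finC[of "\<lambda>_. X" \<pi>]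
      by (simp add: card_Diff_subset card_mono of_nat_diff)
  qed
  finally have "2 * int (card (E_fix (Suc (Suc n)))) =
      (\<Sum>\<pi>\<in>label_perms. 2 * int (card (C \<pi> (\<lambda>_. X))) - 2 * int (card (C \<pi> (Y \<pi>))))"
    by (simp add: sum_distrib_left right_diff_distrib)
  also have "\<dots> = (\<Sum>\<pi>\<in>label_perms. e ^ 3 - ((\<Prod>i\<in>labels. if \<pi> i = i then e - \<phi> else e) +
      sign \<pi> * (\<Prod>i\<in>labels. if \<pi> i = i then - \<delta> else 0)))"
  proof (intro sum.cong refl)
    fix \<pi> :: "nat \<Rightarrow> nat"
    have "int (card (Y \<pi> i)) = (if \<pi> i = i then e - \<phi> else e)" for i
      using finX finF FX
      by (simp add: Y_def e_def \<phi>_def card_Diff_subset card_mono of_nat_diff)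
    moreover have "(\<Sum>\<sigma>\<in>Y \<pi> i. root_sign \<sigma>) = (if \<pi> i = i then - \<delta> else 0)" for i
      using finX FX by (simp add: Y_def \<delta>_def sum_diff balanced)
    ultimately show "2 * int (card (C \<pi> (\<lambda>_. X))) - 2 * int (card (C \<pi> (Y \<pi>))) =
      e ^ 3 - ((\<Prod>i\<in>labels. if \<pi> i = i then e - \<phi> else e) +
      sign \<pi> * (\<Prod>i\<in>labels. if \<pi> i = i then - \<delta> else 0))"
      by (simp add: card_CX card_C[OF Y])
  qed
  \<comment> \<open>The unsigned products sum to
    \<open>(e - \<phi>) ^ 3 + 3 * (e - \<phi>) * e\<^sup>2 + 2 * e ^ 3\<close>. In the signed sum a
    non-fixed label contributes 0 by balance, so only the identity survives, with
    \<open>- \<delta> ^ 3\<close>.\<close>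
  also have "\<dots> = 3 * e\<^sup>2 * \<phi> + e ^ 3 - (e - \<phi>) ^ 3 + \<delta> ^ 3"
    unfolding sum_subtractf sum.distrib sum_prod_fixed_points(1)
      sum_prod_fixed_points(2)[of _ 0, simplified]
    by (simp add: card_permutations[OF refl] fact_numeral)
      (simp add: algebra_simps power2_eq_square power3_eq_cube)
  finally show "2 * int (card (E_fix (Suc (Suc n)))) =
      3 * e\<^sup>2 * \<phi> + e ^ 3 - (e - \<phi>) ^ 3 + \<delta> ^ 3" .
qed

section \<open>Balance of root signs and positivity of the proportion\<close>

lemma Aut_0: "Aut 0 = {id}"
proof -
  have "verts 0 = {[]}"
    by (auto simp: verts_iff)
  then have "Aut 0 \<subseteq> {id}"
    using Aut_permutes[of _ 0] by auto
  moreover have "id \<in> Aut 0"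
    by (simp add: Aut_iff permutes_id)
  ultimately show ?thesis by blast
qed

lemma sum_root_sign_E: "n \<ge> 1 \<Longrightarrow> (\<Sum>\<sigma>\<in>E n. root_sign \<sigma>) = 0"
proof (induction n rule: nat_induct_at_least)
  case base
  have "(\<Sum>\<sigma>\<in>E 1. root_sign \<sigma>) =
      (\<Sum>x\<in>label_perms \<times> (labels \<rightarrow>\<^sub>E Aut 0). root_sign ((\<lambda>(\<pi>, a). glue 0 \<pi> a) x))"
    using sum.reindex_bij_betw[OF bij_betw_glue[of 0], of root_sign] by simp
  also have "\<dots> = (\<Sum>(\<pi>, a)\<in>label_perms \<times> (labels \<rightarrow>\<^sub>E Aut 0). sign \<pi>)"
    by (intro sum.cong) (auto simp: root_perm_glue)
  also have "\<dots> = (\<Sum>\<pi>\<in>label_perms. sign \<pi>)"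
    unfolding sum.cartesian_product[symmetric] by (simp add: card_PiE Aut_0)
  also have "\<dots> = 0"
    unfolding sum_label_perms by (simp add: sign_compose sign_swap_id permutation_swap_id)
  finally show ?case .
next
  case (Suc n)
  then obtain m where "n = Suc m" by (cases n) auto
  then show ?case
    using sum_root_sign_E_Suc_Suc[of m] Suc.IH by (simp only:)
qed

text \<open>Makes the proportion of elements fixing a leaf positive, so that its inverse can be
  studied.\<close>

lemma id_in_E_fix: "id \<in> E_fix n"
proof -
  have Aut: "id \<in> Aut m" for m
    by (simp add: Aut_iff permutes_id)
  have "id \<in> E n"
  proof (induction n rule: induct_nat_012)
    case (ge2 n)
    have "wreath_decomp (Suc n) id (\<lambda>_. id) id"
      using Aut by (simp add: wreath_decomp_def)
    moreover have "sgn2 id = 1"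
    proof -
      have "perm_restrict id (level 2) = id"
        by (simp add: perm_restrict_def fun_eq_iff)
      then show ?thesis
        by (simp add: sgn2_def)
    qed
    ultimately show ?case
      using ge2 Aut[of "Suc (Suc n)"] unfolding E.simps(3) id_def
      by (intro CollectI conjI exI[of _ "\<lambda>_ v. v"] exI[of _ "\<lambda>v. v"]) auto
  qed (simp_all only: E.simps Aut)
  moreover have "replicate n 1 \<in> level n"
    by (auto simp: level_iff labels_def)
  ultimately show ?thesis
    by (auto simp: E_fix_def)
qed

definition fix_ratio :: "nat \<Rightarrow> real" where
  "fix_ratio n = real (card (E_fix n)) / real (card (E n))"

lemma fix_ratio_pos: "fix_ratio n > 0" and fix_ratio_le_1: "fix_ratio n \<le> 1"
proof -
  have "card (E_fix n) > 0"
    using id_in_E_fix[of n] finite_subset[OF E_fix_subset finite_E] by (auto simp: card_gt_0_iff)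
  moreover have "card (E_fix n) \<le> card (E n)"
    by (rule card_mono[OF finite_E E_fix_subset])
  ultimately show "fix_ratio n > 0" "fix_ratio n \<le> 1"
    by (auto simp: fix_ratio_def)
qed

subsection \<open>Asymptotics of the recursion\<close>

text \<open>The remainder is \<open>(f ^ 3 + d ^ 3) / 6\<close> with \<open>f = fix_ratio n\<close>
  and \<open>d\<close> the normalized signed count. Signs have absolute value 1, so
  \<open>\<bar>d\<bar> \<le> f\<close>, and both bounds on \<open>R\<close> follow.\<close>

lemma fix_ratio_Suc:
  assumes "n \<ge> 1"
  obtains R where "fix_ratio (Suc n) = fix_ratio n - fix_ratio n ^ 2 / 2 + R"
    "0 \<le> R" "R \<le> fix_ratio n ^ 3 / 3"
proof -
  obtain m where n: "n = Suc m"
    using assms by (cases n) auto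
  define e \<phi> \<delta> where "e = real (card (E n))" and "\<phi> = real (card (E_fix n))"
    and "\<delta> = real_of_int (\<Sum>\<sigma>\<in>E_fix n. root_sign \<sigma>)"
  note counts = E_Suc_Suc_counts[OF sum_root_sign_E, of m, folded n]
  have e': "real (card (E (Suc n))) = 3 * e ^ 3"
    using arg_cong[OF counts(1)[OF assms], of real_of_int] by (simp add: e_def n del: E.simps)
  have \<phi>': "2 * real (card (E_fix (Suc n))) = 3 * e\<^sup>2 * \<phi> + e ^ 3 - (e - \<phi>) ^ 3 + \<delta> ^ 3"
    using arg_cong[OF counts(3)[OF assms], of real_of_int] by (simp add: e_def \<phi>_def \<delta>_def)
  have f: "fix_ratio n = \<phi> / e"
    by (simp add: fix_ratio_def e_def \<phi>_def)
  have e: "e > 0"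
    using fix_ratio_pos[of n] by (auto simp: f e_def zero_less_divide_iff)
  define d where "d = \<delta> / e"
  have abs_sign: "\<bar>root_sign \<sigma>\<bar> = 1" for \<sigma>
    by (simp add: sign_def)
  have "\<bar>\<Sum>\<sigma>\<in>E_fix n. root_sign \<sigma>\<bar> \<le> (\<Sum>\<sigma>\<in>E_fix n. \<bar>root_sign \<sigma>\<bar>)"
    by (rule sum_abs)
  also have "\<dots> = int (card (E_fix n))"
    by (simp add: abs_sign)
  finally have "\<bar>\<delta>\<bar> \<le> \<phi>"
    unfolding \<delta>_def \<phi>_def by linarith
  then have d: "\<bar>d\<bar> \<le> fix_ratio n"
    using e by (simp add: d_def f divide_right_mono)
  have "\<bar>d ^ 3\<bar> \<le> fix_ratio n ^ 3"
    using power_mono[OF d, of 3] by (simp add: power_abs)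
  moreover have "fix_ratio (Suc n) = fix_ratio n - fix_ratio n ^ 2 / 2 + (fix_ratio n ^ 3 + d ^ 3) / 6"
  proof -
    define g where "g = fix_ratio n"
    \<comment> \<open>The count becomes homogeneous of degree 3 in \<open>e\<close>; the factor
      \<open>6 * e ^ 3\<close> is twice the size of \<open>E (Suc n)\<close>.\<close>
    have "\<phi> = g * e" "\<delta> = d * e"
      using e by (simp_all add: g_def f d_def)
    then have "2 * real (card (E_fix (Suc n))) =
        6 * e ^ 3 * (g - g\<^sup>2 / 2 + (g ^ 3 + d ^ 3) / 6)"
      unfolding \<phi>' by (simp add: algebra_simps power2_eq_square power3_eq_cube)
    then show ?thesis
      unfolding fix_ratio_def[of "Suc n"] e' g_def[symmetric] using e by (simp add: field_simps)
  qed
  ultimately show thesis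
    by (intro that[of "(fix_ratio n ^ 3 + d ^ 3) / 6"]) auto
qed

lemma inverse_fix_ratio_Suc:
  assumes "n \<ge> 1"
  shows "inverse (fix_ratio (Suc n)) - inverse (fix_ratio n) \<ge> 1 / 2 - fix_ratio n / 3"
    and "inverse (fix_ratio (Suc n)) - inverse (fix_ratio n) \<le> 1 / 2 + fix_ratio n / 2"
proof -
  define f where "f = fix_ratio n"
  define f' where "f' = fix_ratio (Suc n)"
  obtain R where R: "f' = f - f\<^sup>2 / 2 + R" "0 \<le> R" "R \<le> f ^ 3 / 3"
    using fix_ratio_Suc[OF assms] unfolding f_def f'_def by metis
  have f: "0 < f" "f \<le> 1" and f': "0 < f'"
    using fix_ratio_pos fix_ratio_le_1 by (auto simp: f_def f'_def)
  \<comment> \<open>The multiplier is \<open>f\<close> times the bound claimed for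
    \<open>inverse f'\<close>. With \<open>x = f / 2 - f\<^sup>2 / 3\<close> the right-hand side is
    \<open>f * (1 + x) * (1 - x)\<close>, hence at most \<open>f\<close>.\<close>
  have "(1 + f / 2 - f\<^sup>2 / 3) * f' \<le> (1 + f / 2 - f\<^sup>2 / 3) * (f - f\<^sup>2 / 2 + f ^ 3 / 3)"
  proof (rule mult_left_mono)
    show "f' \<le> f - f\<^sup>2 / 2 + f ^ 3 / 3"
      using R by simp
    have "f\<^sup>2 \<le> 1"
      using f by (simp add: power_le_one)
    then show "0 \<le> 1 + f / 2 - f\<^sup>2 / 3"
      using f by simp
  qed
  also have "\<dots> = f * (1 - (f / 2 - f\<^sup>2 / 3)\<^sup>2)"
    by (simp add: field_simps power2_eq_square power3_eq_cube)
  also have "\<dots> \<le> f"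
    using f by (simp add: mult_left_le)
  finally have "1 + f / 2 - f\<^sup>2 / 3 \<le> f / f'"
    using f' by (simp add: pos_le_divide_eq)
  then have "(1 + f / 2 - f\<^sup>2 / 3) / f \<le> inverse f'"
    using f f' by (simp add: field_simps)
  then show "inverse (fix_ratio (Suc n)) - inverse (fix_ratio n) \<ge> 1 / 2 - fix_ratio n / 3"
    unfolding f_def[symmetric] f'_def[symmetric] using f
    by (simp add: diff_divide_distrib add_divide_distrib power2_eq_square inverse_eq_divide)
  \<comment> \<open>Again the factor below, \<open>1 + f / 2 + f\<^sup>2 / 2\<close>, is
    \<open>f\<close> times the bound aimed at; its product with \<open>1 - f / 2\<close> exceeds 1
    by \<open>f\<^sup>2 / 4 * (1 - f)\<close>.\<close>
  have "f \<le> f * (1 + f\<^sup>2 / 4 * (1 - f))"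
    using f by simp
  also have "\<dots> = (1 + f / 2 + f\<^sup>2 / 2) * (f - f\<^sup>2 / 2)"
    by (simp add: field_simps power2_eq_square)
  also have "\<dots> \<le> (1 + f / 2 + f\<^sup>2 / 2) * f'"
    using R f by (intro mult_left_mono) auto
  finally have "f / f' \<le> 1 + f / 2 + f\<^sup>2 / 2"
    using f' by (simp add: pos_divide_le_eq)
  then have "inverse f' \<le> (1 + f / 2 + f\<^sup>2 / 2) / f"
    using f f' by (simp add: field_simps)
  then show "inverse (fix_ratio (Suc n)) - inverse (fix_ratio n) \<le> 1 / 2 + fix_ratio n / 2"
    unfolding f_def[symmetric] f'_def[symmetric] using f
    by (simp add: add_divide_distrib power2_eq_square inverse_eq_divide)
qed

text \<open>As \<open>fix_ratio n \<le> 1\<close>, the inverse grows by at least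
  \<open>1 / 2 - 1 / 3 = 1 / 6\<close> in each step.\<close>

lemma fix_ratio_le: "n \<ge> 1 \<Longrightarrow> fix_ratio n \<le> 6 / real n"
proof -
  assume n: "n \<ge> 1"
  have "real n / 6 \<le> inverse (fix_ratio n)"
    using n
  proof (induction n rule: nat_induct_at_least)
    case base
    have "1 \<le> inverse (fix_ratio 1)"
      using fix_ratio_pos fix_ratio_le_1 by (simp add: one_le_inverse_iff)
    then show ?case by simp
  next
    case (Suc n)
    then show ?case
      using inverse_fix_ratio_Suc(1)[of n] fix_ratio_le_1[of n] by simp
  qed
  then show ?thesis
    using n fix_ratio_pos[of n] by (simp add: field_simps)
qed

text \<open>Each increment of the inverse differs from \<open>1 / 2\<close> by at most
  \<open>fix_ratio n / 2 \<le> 3 / n\<close>. These errors are bounded by differences of logarithms,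
  which telescope.\<close>

lemma inverse_fix_ratio_asymp:
  "n \<ge> 1 \<Longrightarrow> \<bar>inverse (fix_ratio n) - real n / 2\<bar> \<le> inverse (fix_ratio 1) + 6 * ln (real n)"
proof (induction n rule: nat_induct_at_least)
  case base
  have "1 \<le> inverse (fix_ratio 1)"
    using fix_ratio_pos fix_ratio_le_1 by (simp add: one_le_inverse_iff)
  then show ?case by simp
next
  case (Suc n)
  have "\<bar>(inverse (fix_ratio (Suc n)) - real (Suc n) / 2) - (inverse (fix_ratio n) - real n / 2)\<bar>
      \<le> fix_ratio n / 2"
  proof -
    have "\<bar>(b - real (Suc n) / 2) - (a - real n / 2)\<bar> \<le> f / 2"
      if "b - a \<ge> 1 / 2 - f / 3" "b - a \<le> 1 / 2 + f / 2" "f > 0" for a b f :: real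
    proof -
      have "(b - real (Suc n) / 2) - (a - real n / 2) = b - a - 1 / 2"
        by (simp add: field_simps)
      then show ?thesis using that by linarith
    qed
    then show ?thesis
      using inverse_fix_ratio_Suc[OF Suc.hyps] fix_ratio_pos[of n] by blast
  qed
  also have "\<dots> \<le> 3 / real n"
    using fix_ratio_le[OF Suc.hyps] by simp
  also have "\<dots> \<le> 6 / real (Suc n)"
    using Suc.hyps by (simp add: field_simps)
  \<comment> \<open>This is \<open>ln x \<le> x - 1\<close> at
    \<open>x = n / (n + 1)\<close>.\<close>
  also have "\<dots> \<le> 6 * (ln (real (Suc n)) - ln (real n))"
  proof -
    have "ln (real n / real (Suc n)) \<le> real n / real (Suc n) - 1"
      using Suc.hyps by (intro ln_le_minus_one) simp
    also have "\<dots> = - (1 / real (Suc n))"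
      by (simp add: field_simps)
    finally show ?thesis
      using Suc.hyps by (simp add: ln_div)
  qed
  finally have step: "\<bar>(inverse (fix_ratio (Suc n)) - real (Suc n) / 2) - (inverse (fix_ratio n) - real n / 2)\<bar>
      \<le> 6 * (ln (real (Suc n)) - ln (real n))" .
  have "\<bar>y\<bar> \<le> c + 6 * l'" if "\<bar>y - x\<bar> \<le> 6 * (l' - l)" "\<bar>x\<bar> \<le> c + 6 * l" for x y c l l' :: real
    using that abs_triangle_ineq[of "y - x" x] by simp
  from this[OF step Suc.IH] show ?case .
qed

theorem theorem5p1:
  shows "\<exists>\<epsilon> \<in> O(\<lambda>n::nat. ln (real n) / real n).
    \<forall>n::nat\<ge>1. real (card (E_fix n)) / real (card (E n)) = 2 / real n * (1 + \<epsilon> n)"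
proof
  \<comment> \<open>Solving the claimed identity for the error gives
    \<open>fix_ratio n * n / 2 - 1\<close>. Factoring out \<open>fix_ratio n\<close> displays it as
    a term of order \<open>1 / n\<close> times one of order \<open>ln n\<close>.\<close>
  define \<epsilon> where "\<epsilon> n = fix_ratio n * (real n / 2 - inverse (fix_ratio n))" for n
  define c where "c = inverse (fix_ratio 1)"
  have c: "c > 0"
    using fix_ratio_pos by (simp add: c_def)
  show "\<forall>n\<ge>1. real (card (E_fix n)) / real (card (E n)) = 2 / real n * (1 + \<epsilon> n)"
  proof safe
    fix n :: nat assume "n \<ge> 1"
    moreover have "\<epsilon> n = fix_ratio n * real n / 2 - 1"
      using fix_ratio_pos[of n] by (simp add: \<epsilon>_def field_simps)
    ultimately show "real (card (E_fix n)) / real (card (E n)) = 2 / real n * (1 + \<epsilon> n)"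
      by (simp add: fix_ratio_def)
  qed
  show "\<epsilon> \<in> O(\<lambda>n::nat. ln (real n) / real n)"
  proof (rule bigoI)
    \<comment> \<open>From \<open>n = 3\<close> on, \<open>ln n \<ge> 1\<close>, so the constant
      \<open>c\<close> is absorbed into \<open>c * ln n\<close>; the outer 6 comes from
      \<open>fix_ratio_le\<close> and the inner one from
      \<open>inverse_fix_ratio_asymp\<close>.\<close>
    show "\<forall>\<^sub>F n in sequentially. norm (\<epsilon> n) \<le> (6 * (c + 6)) * norm (ln (real n) / real n)"
      using eventually_ge_at_top[of 3]
    proof eventually_elim
      case (elim n)
      then have n: "n \<ge> 1" "real n \<ge> 3" by auto
      have ln: "ln (real n) \<ge> 1"
        using n(2) exp_le by (subst ln_ge_iff) auto
      have "\<bar>\<epsilon> n\<bar> = fix_ratio n * \<bar>inverse (fix_ratio n) - real n / 2\<bar>"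
        using fix_ratio_pos[of n] by (simp add: \<epsilon>_def abs_mult abs_minus_commute)
      also have "\<dots> \<le> 6 / real n * (c + 6 * ln (real n))"
        using fix_ratio_le[OF n(1)] inverse_fix_ratio_asymp[OF n(1)] n
        unfolding c_def by (intro mult_mono) auto
      also have "\<dots> \<le> 6 / real n * (c * ln (real n) + 6 * ln (real n))"
        using ln c n by (intro mult_left_mono) auto
      also have "\<dots> = (6 * (c + 6)) * norm (ln (real n) / real n)"
        using ln n by (simp add: field_simps)
      finally show ?case by simp
    qed
  qed
qed

end
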